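(* For every gauge function $\varphi$ there exists a separable metric space $(X,d)$ of cardinality $\operatorname{cov}\mathcal{M}$ with $\mathcal{H}^{\varphi}(X)>0$.
   Context: A gauge function is a strictly increasing bijection $\varphi:[0,\infty)\to[0,\infty)$, and $\mathcal{H}^{\varphi}$ is the Hausdorff measure with gauge $\varphi$, i.e. $\mathcal{H}^\varphi(X)=\lim_{\delta\to0}\inf\{\sum_i\varphi(\operatorname{diam}E_i): X\subset\bigcup_i E_i,\ \operatorname{diam}E_i\le\delta\}$. $\mathcal{M}$ is the collection of first category subsets of $\mathbb{R}$ and $\operatorname{cov}\mathcal{M}$ is the least cardinality of a family of first category subsets of $\mathbb{R}$ covering $\mathbb{R}$. *)

theory Defs
  imports "HOL-Analysis.Analysis" "HOL-Library.Equipollence"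
begin

definition gauge_function :: "(real \<Rightarrow> real) \<Rightarrow> bool" where
  "gauge_function \<phi> \<longleftrightarrow> strict_mono_on {0..} \<phi> \<and> bij_betw \<phi> {0..} {0..}"

text \<open>Diameter of a subset of a metric space (0 for the empty set, \<infinity> if unbounded).\<close>
definition mdiam :: "('a \<Rightarrow> 'a \<Rightarrow> real) \<Rightarrow> 'a set \<Rightarrow> ereal" where
  "mdiam d E = Sup (insert 0 {ereal (d x y) | x y. x \<in> E \<and> y \<in> E})"

definition hausdorff_pre ::
  "(real \<Rightarrow> real) \<Rightarrow> 'a set \<Rightarrow> ('a \<Rightarrow> 'a \<Rightarrow> real) \<Rightarrow> real \<Rightarrow> 'a set \<Rightarrow> ennreal" where
  "hausdorff_pre \<phi> M d \<delta> A =
     (INF E \<in> {E :: nat \<Rightarrow> 'a set. A \<subseteq> (\<Union>i. E i) \<and> (\<forall>i. E i \<subseteq> M \<and> mdiam d (E i) \<le> ereal \<delta>)}.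
        (\<Sum>i. ennreal (\<phi> (real_of_ereal (mdiam d (E i))))))"

text \<open>Hausdorff measure: limit as delta tends to 0, which is the supremum since the
  approximating contents increase as delta decreases.\<close>
definition hausdorff_measure ::
  "(real \<Rightarrow> real) \<Rightarrow> 'a set \<Rightarrow> ('a \<Rightarrow> 'a \<Rightarrow> real) \<Rightarrow> 'a set \<Rightarrow> ennreal" where
  "hausdorff_measure \<phi> M d A = (SUP \<delta> \<in> {0<..}. hausdorff_pre \<phi> M d \<delta> A)"

definition nowhere_dense :: "real set \<Rightarrow> bool" where
  "nowhere_dense A \<longleftrightarrow> interior (closure A) = {}"

definition first_category :: "real set \<Rightarrow> bool" where
  "first_category A \<longleftrightarrow> (\<exists>\<F>. countable \<F> \<and> (\<forall>N\<in>\<F>. nowhere_dense N) \<and> A \<subseteq> \<Union>\<F>)"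

definition has_card_cov_meager :: "'a set \<Rightarrow> bool" where
  "has_card_cov_meager S \<longleftrightarrow>
     (\<exists>\<F>. (\<forall>A\<in>\<F>. first_category A) \<and> \<Union>\<F> = UNIV \<and> S \<approx> \<F>) \<and>
     (\<forall>\<F>. (\<forall>A\<in>\<F>. first_category A) \<and> \<Union>\<F> = UNIV \<longrightarrow> S \<lesssim> \<F>)"

end

theory Submission
  imports Defs
begin

text \<open>
  A family of meager sets \<open>M x\<close> (\<open>x \<in> X\<close>) covering the line yields, by an argument of
  Bartoszynski, functions \<open>f x \<in> \<nat>\<^sup>\<nat>\<close> such that every \<open>g \<in> \<nat>\<^sup>\<nat>\<close> is eventually different from
  some \<open>f x\<close>. Otherwise one guesses first a sequence \<open>j\<close> that infinitely often outgrows each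
  cover member, and then, along these infinitely many places, a finite table which sends each of
  the first \<open>j n\<close> rational intervals to a subinterval missing the first \<open>n\<close> nowhere dense pieces
  of \<open>M x\<close>; following the guessed tables produces a point outside every \<open>M x\<close>.

  On the index set of a minimal cover take the distance \<open>r n\<close>, where \<open>n\<close> is the first difference
  of the functions and \<open>\<phi> (r n) = 1 / (n + 1)\<close>. If the Hausdorff measure vanished, there would
  be countably many sets of total gauge below 1 containing each point infinitely often; listed by
  decreasing size, the \<open>n\<close>-th one has diameter below \<open>r n\<close>, so it determines the \<open>n\<close>-th
  coordinate of its points. These coordinates form a \<open>g\<close> that meets every \<open>f x\<close> infinitely often.
\<close>

section \<open>Closed rational intervals and nowhere dense sets\<close>

text \<open>Compact cells give a nested sequence a common point, and numbering them turns the choice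
  of a subinterval into a number that can be guessed.\<close>

lemma rational_cells:
  obtains c :: "nat \<Rightarrow> real set"
  where "\<And>i. \<exists>a b. a < b \<and> c i = {a..b}"
    and "\<And>a b. a < b \<Longrightarrow> \<exists>k. c k \<subseteq> {a<..<b}"
proof
  define c :: "nat \<Rightarrow> real set" where
    \<comment> \<open>The default \<open>{0..1}\<close> keeps the cell nondegenerate when the code
      is not an increasing pair.\<close>
    "c k = (let (p, q) = (from_nat k :: rat \<times> rat) in if p < q then {of_rat p..of_rat q} else {0..1})" for k
  show "\<exists>a b. a < b \<and> c i = {a..b}" for i
  proof -
    obtain p q where pq: "from_nat i = (p :: rat, q :: rat)" by fastforce
    show ?thesis
    proof (cases "p < q")
      case True
      then show ?thesis
        using pq by (intro exI[of _ "of_rat p"] exI[of _ "of_rat q"]) (simp add: c_def of_rat_less)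
    next
      case False
      then show ?thesis using pq by (intro exI[of _ 0] exI[of _ 1]) (simp add: c_def)
    qed
  qed
  show "\<exists>k. c k \<subseteq> {a<..<b}" if ab: "a < b" for a b :: real
  proof -
    obtain q :: rat where q: "a < of_rat q" "of_rat q < b" using of_rat_dense[OF ab] by blast
    obtain p :: rat where p: "a < of_rat p" "of_rat p < (of_rat q :: real)" using of_rat_dense[OF q(1)] by blast
    have "p < q" using p(2) by (simp add: of_rat_less)
    then have "c (to_nat (p, q)) = {of_rat p..of_rat q}" by (simp add: c_def)
    then show ?thesis using p q by (intro exI[of _ "to_nat (p, q)"]) auto
  qed
qed

lemma nowhere_dense_avoid_interval:
  assumes "nowhere_dense N" "a < b"
  obtains a' b' where "a' < b'" "{a'<..<b'} \<subseteq> {a..b} - N"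
proof -
  let ?U = "{a<..<b} - closure N"
  have "?U \<noteq> {}"
    using assms interior_maximal[of "{a<..<b}" "closure N"] unfolding nowhere_dense_def by auto
  then obtain z where z: "z \<in> ?U" by blast
  have "open ?U" by (simp add: open_Diff)
  then obtain e where e: "e > 0" "ball z e \<subseteq> ?U" using z open_contains_ball by blast
  have "{z - e<..<z + e} \<subseteq> {a..b} - N"
    using e(2) closure_subset[of N] by (force simp: ball_eq_greaterThanLessThan)
  with e(1) show thesis by (intro that[of "z - e" "z + e"]) auto
qed

lemma finitely_many_nowhere_dense_avoid_cell:
  fixes c :: "nat \<Rightarrow> real set"
  assumes c: "\<And>i. \<exists>a b. a < b \<and> c i = {a..b}"
    and dense: "\<And>a b. a < b \<Longrightarrow> \<exists>k. c k \<subseteq> {a<..<b}"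
    and N: "\<And>n::nat. nowhere_dense (N n)"
  shows "\<exists>k. c k \<subseteq> c i \<and> (\<forall>m\<le>n. c k \<inter> N m = {})"
proof -
  have step: "\<exists>k. c k \<subseteq> c i \<and> c k \<inter> N m = {}" for i m
  proof -
    obtain a b where ab: "a < b" "c i = {a..b}" using c by blast
    obtain a' b' where "a' < b'" "{a'<..<b'} \<subseteq> {a..b} - N m"
      using nowhere_dense_avoid_interval[OF N ab(1)] by blast
    with dense[of a' b'] ab(2) show ?thesis by blast
  qed
  show ?thesis
  proof (induction n)
    case 0
    show ?case using step[of i 0] by simp
  next
    case (Suc n)
    then obtain k where k: "c k \<subseteq> c i" "\<forall>m\<le>n. c k \<inter> N m = {}" by blast
    obtain k' where k': "c k' \<subseteq> c k" "c k' \<inter> N (Suc n) = {}" using step by blast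
    have "c k' \<inter> N m = {}" if "m \<le> Suc n" for m
      using that k k' by (cases "m = Suc n") (auto simp: le_Suc_eq)
    with k k' show ?case by blast
  qed
qed

section \<open>Guesses that are correct infinitely often\<close>

text \<open>
  Guessing \<open>u x \<circ> u x\<close> rather than \<open>u x\<close> lets a guess at a point between \<open>j n\<close> and \<open>j (n + 1)\<close>
  succeed at one of the two endpoints.
\<close>
lemma escaping_sequence:
  fixes u :: "'i \<Rightarrow> nat \<Rightarrow> nat"
  assumes guess: "\<And>h :: 'i \<Rightarrow> nat \<Rightarrow> nat. \<exists>g. \<forall>x\<in>X. infinite {n. h x n = g n}"
    and mono: "\<And>x. x \<in> X \<Longrightarrow> mono (u x)"
  obtains j :: "nat \<Rightarrow> nat"
  where "strict_mono j" "\<And>x. x \<in> X \<Longrightarrow> infinite {n. u x (j n) \<le> j (Suc n)}"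
proof -
  obtain g where g: "\<forall>x\<in>X. infinite {m. u x (u x m) = g m}"
    using guess[of "\<lambda>x m. u x (u x m)"] by blast
  \<comment> \<open>The sum dominates every \<open>g i\<close> with \<open>i \<le> m\<close>; the
    summand \<open>Suc m\<close> makes the orbit \<open>j\<close> of 0 strictly increasing.\<close>
  define G where "G m = Suc m + (\<Sum>i\<le>m. g i)" for m
  define j where "j n = (G ^^ n) 0" for n
  have j_Suc: "j (Suc n) = G (j n)" for n by (simp add: j_def)
  have sm: "strict_mono j" by (rule strict_monoI_Suc) (simp add: j_Suc G_def)
  have g_le: "g m \<le> G k" if "m \<le> k" for m k
    using member_le_sum[of m "{..k}" g] that by (simp add: G_def)
  have "infinite {n. u x (j n) \<le> j (Suc n)}" if x: "x \<in> X" for x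
    unfolding infinite_nat_iff_unbounded_le
  proof
    fix N
    obtain m where m: "m \<ge> j N" "u x (u x m) = g m"
      using g x unfolding infinite_nat_iff_unbounded_le by blast
    define k where "k = (LEAST k. m < j k)"
    have ex: "m < j (Suc m)" using strict_mono_imp_increasing[OF sm, of "Suc m"] by simp
    have k: "m < j k" unfolding k_def by (rule LeastI[of _ "Suc m"]) (rule ex)
    have "N < k" using k m(1) strict_mono_less[OF sm, of N k] by linarith
    then obtain n where n: "k = Suc n" "N \<le> n" by (cases k) auto
    have jn: "j n \<le> m" using not_less_Least[of n "\<lambda>k. m < j k"] n unfolding k_def by auto
    show "\<exists>n\<ge>N. n \<in> {n. u x (j n) \<le> j (Suc n)}"
    proof (cases "u x (j n) \<le> j (Suc n)")
      case True
      then show ?thesis using n by blast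
    next
      case False
      \<comment> \<open>Failure at \<open>n\<close> pushes \<open>u x m\<close> past
        \<open>j (Suc n)\<close>. A second application of \<open>u x\<close> then bounds
        \<open>u x (j (Suc n))\<close> by the guess \<open>g m\<close>, so \<open>Suc n\<close>
        succeeds.\<close>
      then have "j (Suc n) \<le> u x m" using monoD[OF mono[OF x] jn] by simp
      then have "u x (j (Suc n)) \<le> g m" using monoD[OF mono[OF x]] m(2) by metis
      also have "\<dots> \<le> j (Suc (Suc n))" using g_le[of m "j (Suc n)"] k n by (simp add: j_Suc[of "Suc n"])
      finally show ?thesis using n by (intro exI[of _ "Suc n"]) simp
    qed
  qed
  with sm show thesis by (rule that)
qed

text \<open>A greedy choice works: at most \<open>n\<close> values are taken before choosing from
  \<open>B n\<close>.\<close>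

lemma distinct_representatives:
  fixes B :: "nat \<Rightarrow> 'a set"
  assumes "\<And>n. finite (B n)" "\<And>n. n < card (B n)"
  obtains k where "inj k" "\<And>n. k n \<in> B n"
proof -
  have "\<exists>k. \<forall>n. k n \<in> B n - k ` {..<n}"
  proof (rule dependent_wf_choice[where R = less_than and P = "\<lambda>k n r. r \<in> B n - k ` {..<n}"])
    show "\<exists>r. r \<in> B n - k ` {..<n}" for n and k :: "nat \<Rightarrow> 'a"
    proof -
      have "card (k ` {..<n}) < card (B n)"
        using card_image_le[of "{..<n}" k] assms(2)[of n] by simp
      then show ?thesis by (metis Diff_eq_empty_iff card_mono equals0I finite_imageI finite_lessThan not_less)
    qed
  qed (auto simp: image_def)
  then obtain k where k: "\<And>n. k n \<in> B n - k ` {..<n}" by blast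
  have "inj k"
  proof (rule linorder_injI)
    show "k m \<noteq> k n" if "m < n" for m n
      using k[of n] that by (metis DiffD2 imageI lessThan_iff)
  qed
  with k show thesis using that by blast
qed

text \<open>The set \<open>A x\<close> varies with \<open>x\<close>, so places have to be guessed
  together with values.\<close>

lemma guess_along_infinite_sets:
  fixes h :: "'i \<Rightarrow> nat \<Rightarrow> 'b::countable"
  assumes guess: "\<And>h :: 'i \<Rightarrow> nat \<Rightarrow> nat. \<exists>g. \<forall>x\<in>X. infinite {n. h x n = g n}"
    and A: "\<And>x. x \<in> X \<Longrightarrow> infinite (A x)"
  shows "\<exists>g. \<forall>x\<in>X. infinite {n \<in> A x. h x n = g n}"
proof -
  \<comment> \<open>a correct guess of \<open>n + 1\<close> values leaves at least one place not used by the \<open>n\<close> earlier guesses\<close>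
  define L where "L x n = map (\<lambda>i. (enumerate (A x) i, h x (enumerate (A x) i))) [0..<Suc n]" for x n
  obtain G0 where G0: "\<forall>x\<in>X. infinite {n. to_nat (L x n) = G0 n}"
    using guess[of "\<lambda>x n. to_nat (L x n)"] by blast
  define G :: "nat \<Rightarrow> (nat \<times> 'b) list" where "G n = from_nat (G0 n)" for n
  have G: "infinite {n. L x n = G n}" if "x \<in> X" for x
    by (rule infinite_super[OF _ G0[rule_format, OF that]]) (auto simp: G_def dest: sym)
  \<comment> \<open>A guess naming too few places is replaced by \<open>{..n}\<close>, which still
    leaves room for a new representative.\<close>
  define B where "B n = (if n < card (fst ` set (G n)) then fst ` set (G n) else {..n})" for n
  obtain k where k: "inj k" "\<And>n. k n \<in> B n"
    by (rule distinct_representatives[of B]) (auto simp: B_def)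
  \<comment> \<open>On the range of \<open>k\<close> the value is read off the one guess whose
    representative is \<open>m\<close>; elsewhere it is arbitrary.\<close>
  define g where "g m = the (map_of (G (inv k m)) m)" for m
  have hit: "k n \<in> A x \<and> h x (k n) = g (k n)" if x: "x \<in> X" and n: "L x n = G n" for x n
  proof -
    let ?e = "enumerate (A x)"
    have fs: "fst ` set (G n) = ?e ` {..n}"
      unfolding n[symmetric] L_def by (force simp: image_iff)
    have "inj ?e" using strict_mono_enumerate[OF A[OF x]] by (simp add: strict_mono_imp_inj_on)
    then have "card (fst ` set (G n)) = Suc n"
      unfolding fs by (subst card_image) (auto intro: inj_on_subset)
    then have kn: "k n \<in> fst ` set (G n)" using k(2)[of n] by (simp add: B_def)
    then obtain i where i: "k n = ?e i" using fs by auto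
    obtain v where v: "map_of (G n) (k n) = Some v"
      using kn by (metis map_of_eq_None_iff not_None_eq)
    then have "(k n, v) \<in> set (L x n)" using n by (metis map_of_SomeD)
    then have "v = h x (k n)" by (auto simp: L_def)
    then have "h x (k n) = g (k n)" using v k(1) by (simp add: g_def)
    moreover have "k n \<in> A x" using i enumerate_in_set[OF A[OF x]] by simp
    ultimately show ?thesis by blast
  qed
  have "infinite {n \<in> A x. h x n = g n}" if x: "x \<in> X" for x
  proof -
    have "infinite (k ` {n. L x n = G n})"
      using G[OF x] k(1) finite_imageD inj_on_subset by blast
    then show ?thesis by (rule infinite_super[rotated]) (use hit[OF x] in auto)
  qed
  then show ?thesis by blast
qed

section \<open>From a cover by meager sets to eventually different functions\<close>

lemma first_category_sequence:
  assumes "first_category A"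
  obtains N :: "nat \<Rightarrow> real set" where "\<And>n. nowhere_dense (N n)" "A \<subseteq> (\<Union>n. N n)"
proof -
  obtain \<F> where F: "countable \<F>" "\<forall>N\<in>\<F>. nowhere_dense N" "A \<subseteq> \<Union>\<F>"
    using assms unfolding first_category_def by blast
  \<comment> \<open>Adding the empty set allows an enumeration even of an empty family.\<close>
  let ?N = "from_nat_into (insert {} \<F>)"
  have r: "range ?N = insert {} \<F>" using F(1) by (simp add: range_from_nat_into)
  show thesis
  proof (rule that[of ?N])
    show "nowhere_dense (?N n)" for n
      using F(2) from_nat_into[of "insert {} \<F>" n] by (auto simp: nowhere_dense_def)
    show "A \<subseteq> (\<Union>n. ?N n)" using F(3) r by auto
  qed
qed

theorem eventually_different_family:
  fixes M :: "'i \<Rightarrow> real set"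
  assumes meager: "\<And>x. x \<in> X \<Longrightarrow> first_category (M x)"
    and cover: "(\<Union>x\<in>X. M x) = UNIV"
  obtains f :: "'i \<Rightarrow> nat \<Rightarrow> nat" where "\<And>g. \<exists>x\<in>X. finite {n. f x n = g n}"
proof (rule ccontr)
  assume "\<not> thesis"
  then have guess: "\<exists>g. \<forall>x\<in>X. infinite {n. h x n = g n}" for h :: "'i \<Rightarrow> nat \<Rightarrow> nat"
    using that by blast
  obtain c :: "nat \<Rightarrow> real set" where c: "\<And>i. \<exists>a b. a < b \<and> c i = {a..b}"
    "\<And>a b. a < b \<Longrightarrow> \<exists>k. c k \<subseteq> {a<..<b}" by (rule rational_cells) blast
  have "\<forall>x\<in>X. \<exists>N :: nat \<Rightarrow> real set. (\<forall>n. nowhere_dense (N n)) \<and> M x \<subseteq> (\<Union>n. N n)"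
    using first_category_sequence[OF meager] by metis
  then obtain N :: "'i \<Rightarrow> nat \<Rightarrow> real set" where
    N: "\<And>x n. x \<in> X \<Longrightarrow> nowhere_dense (N x n)" "\<And>x. x \<in> X \<Longrightarrow> M x \<subseteq> (\<Union>n. N x n)"
    by metis
  have "\<forall>x\<in>X. \<forall>i n. \<exists>k. c k \<subseteq> c i \<and> (\<forall>m\<le>n. c k \<inter> N x m = {})"
    using finitely_many_nowhere_dense_avoid_cell[OF c] N(1) by blast
  then obtain e where e: "\<And>x i n. x \<in> X \<Longrightarrow> c (e x i n) \<subseteq> c i"
    "\<And>x i n m. x \<in> X \<Longrightarrow> m \<le> n \<Longrightarrow> c (e x i n) \<inter> N x m = {}" by metis
  \<comment> \<open>A monotone bound for all indices \<open>e x i n\<close> with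
    \<open>i, n \<le> m\<close>.\<close>
  define u where "u x m = (\<Sum>p\<in>{..m} \<times> {..m}. e x (fst p) (snd p))" for x m
  have "mono (u x)" for x
    unfolding u_def by (intro monoI sum_mono2) auto
  then obtain j where j: "strict_mono j" "\<And>x. x \<in> X \<Longrightarrow> infinite {n. u x (j n) \<le> j (Suc n)}"
    using escaping_sequence[OF guess] by metis
  have "\<exists>g. \<forall>x\<in>X. infinite {n \<in> {n. u x (j n) \<le> j (Suc n)}.
      map (\<lambda>i. e x i n) [0..<Suc (j n)] = g n}"
    by (rule guess_along_infinite_sets[OF guess]) (rule j(2))
  then obtain g :: "nat \<Rightarrow> nat list" where g: "\<And>x. x \<in> X \<Longrightarrow>
      infinite {n \<in> {n. u x (j n) \<le> j (Suc n)}. map (\<lambda>i. e x i n) [0..<Suc (j n)] = g n}"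
    by blast
  \<comment> \<open>A table entry is followed only if it is small and shrinks the cell. Thus, even
    under wrong guesses, the cells are nested and \<open>s n \<le> j n\<close>, so a correct table
    has an entry for \<open>s n\<close>.\<close>
  define s where "s = rec_nat 0 (\<lambda>n k. if g n ! k \<le> j (Suc n) \<and> c (g n ! k) \<subseteq> c k then g n ! k else k)"
  have s_Suc: "s (Suc n) = (if g n ! s n \<le> j (Suc n) \<and> c (g n ! s n) \<subseteq> c (s n) then g n ! s n else s n)" for n
    by (simp add: s_def)
  have s_le: "s n \<le> j n" for n
  proof (induction n)
    case 0
    show ?case by (simp add: s_def)
  next
    case (Suc n)
    then show ?case using strict_mono_less_eq[OF j(1), of n "Suc n"] by (simp add: s_Suc)
  qed
  have anti: "c (s n) \<subseteq> c (s m)" if "m \<le> n" for m n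
    using that by (rule lift_Suc_antimono_le[rotated]) (simp add: s_Suc)
  have "compact (c i) \<and> c i \<noteq> {}" for i using c(1)[of i] by auto
  then have "(\<Inter>n. c (s n)) \<noteq> {}" by (intro compact_nest anti) auto
  then obtain y where y: "\<And>n. y \<in> c (s n)" by auto
  obtain x where x: "x \<in> X" "y \<in> M x" using cover by blast
  then obtain m where m: "y \<in> N x m" using N(2) by blast
  \<comment> \<open>At this place the guess is correct and its entry passes both tests, so the next
    cell misses \<open>N x m\<close>.\<close>
  obtain n where n: "m \<le> n" "u x (j n) \<le> j (Suc n)" "map (\<lambda>i. e x i n) [0..<Suc (j n)] = g n"
    using g[OF x(1)] unfolding infinite_nat_iff_unbounded_le by blast
  have "n \<le> j n" using strict_mono_imp_increasing[OF j(1)] .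
  then have "e x (s n) n \<le> u x (j n)"
    using s_le[of n] member_le_sum[of "(s n, n)" "{..j n} \<times> {..j n}" "\<lambda>p. e x (fst p) (snd p)"]
    by (simp add: u_def)
  moreover have gs: "g n ! s n = e x (s n) n"
    unfolding n(3)[symmetric] using s_le[of n] by (subst nth_map) (auto simp del: upt_Suc)
  ultimately have "s (Suc n) = e x (s n) n"
    using n(2) e(1)[OF x(1), of "s n" n] by (simp add: s_Suc)
  then show False using y[of "Suc n"] e(2)[OF x(1) n(1), of "s n"] m by auto
qed

section \<open>From eventually different functions to positive Hausdorff measure\<close>

text \<open>Rank by decreasing size, ties broken by index. A term of rank \<open>n\<close> and its
  \<open>n\<close> predecessors are all at least as large as that term and sum to at most 1.\<close>

lemma rank_injection:
  fixes a :: "nat \<Rightarrow> real"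
  assumes pos: "\<And>p. a p > 0" and sum: "\<And>S. finite S \<Longrightarrow> sum a S \<le> 1"
  obtains n :: "nat \<Rightarrow> nat" where "inj n" "\<And>p. a p \<le> 1 / (real (n p) + 1)"
proof -
  have bound: "real (card S) * a p \<le> 1" if "finite S" "\<And>q. q \<in> S \<Longrightarrow> a p \<le> a q" for S p
    using sum_bounded_below[of S "a p" a] that sum[of S] by fastforce
  have fin: "finite {q. a p \<le> a q}" for p
  proof (rule ccontr)
    assume inf: "infinite {q. a p \<le> a q}"
    obtain K :: nat where K: "1 < real K * a p" using reals_Archimedean3[OF pos] by blast
    obtain S where "S \<subseteq> {q. a p \<le> a q}" "finite S" "card S = K"
      using infinite_arbitrarily_large[OF inf] by blast
    then show False using bound[of S p] K by auto
  qed
  define D where "D p = {q. a p < a q \<or> a p = a q \<and> q < p}" for p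
  have finD: "finite (D p)" for p by (rule finite_subset[OF _ fin[of p]]) (auto simp: D_def)
  have "D p \<subset> D q \<or> D q \<subset> D p" if "p \<noteq> q" for p q
  proof -
    have "q \<in> D p \<and> D q \<subseteq> D p \<and> q \<notin> D q \<or> p \<in> D q \<and> D p \<subseteq> D q \<and> p \<notin> D p"
      using that unfolding D_def by (cases "a p" "a q" rule: linorder_cases; cases p q rule: linorder_cases) auto
    then show ?thesis by blast
  qed
  then have "inj (\<lambda>p. card (D p))"
    by (intro injI) (metis finD psubset_card_mono less_irrefl)
  moreover have "a p \<le> 1 / (real (card (D p)) + 1)" for p
  proof -
    have "card (insert p (D p)) = Suc (card (D p))" using finD by (simp add: D_def)
    moreover have "a p \<le> a q" if "q \<in> insert p (D p)" for q using that by (auto simp: D_def)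
    ultimately have "(real (card (D p)) + 1) * a p \<le> 1"
      using bound[of "insert p (D p)" p] finD by (simp add: add.commute)
    then show ?thesis by (simp add: field_simps)
  qed
  ultimately show thesis by (rule that)
qed

text \<open>The usual ultrametric of Baire space pulled back along \<open>f\<close>, with radii left
  free so that they can be fitted to the gauge.\<close>

definition first_difference_dist ::
  "(nat \<Rightarrow> real) \<Rightarrow> ('a \<Rightarrow> nat \<Rightarrow> nat) \<Rightarrow> 'a \<Rightarrow> 'a \<Rightarrow> real" where
  "first_difference_dist r f x y = (if x = y then 0 else r (LEAST n. f x n \<noteq> f y n))"

locale first_difference =
  fixes r :: "nat \<Rightarrow> real" and f :: "'a \<Rightarrow> nat \<Rightarrow> nat"
  assumes inj: "inj f" and r_pos: "\<And>n. 0 < r n" and r_anti: "\<And>m n. m \<le> n \<Longrightarrow> r n \<le> r m"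
begin

abbreviation "d \<equiv> first_difference_dist r f"

lemma r_le_dist: "f x n \<noteq> f y n \<Longrightarrow> r n \<le> d x y"
  unfolding first_difference_dist_def by (auto intro: r_anti Least_le)

lemma dist_le_r:
  assumes "\<And>m. m < n \<Longrightarrow> f x m = f y m"
  shows "d x y \<le> r n"
proof (cases "x = y")
  case True
  then show ?thesis using r_pos[of n] by (simp add: first_difference_dist_def)
next
  case False
  then obtain k where k: "f x k \<noteq> f y k" using inj by (metis ext injD)
  have "n \<le> (LEAST n. f x n \<noteq> f y n)"
    using LeastI[of "\<lambda>n. f x n \<noteq> f y n", OF k] assms not_le by blast
  then show ?thesis using False by (simp add: first_difference_dist_def r_anti)
qed

lemma Metric_space: "Metric_space X d"
proof
  show nonneg: "0 \<le> d x y" for x y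
    by (simp add: first_difference_dist_def less_imp_le r_pos)
  show "d x y = d y x" for x y
    by (auto simp: first_difference_dist_def eq_commute)
  show "d x y = 0 \<longleftrightarrow> x = y" for x y
    using r_pos by (auto simp: first_difference_dist_def less_le)
  show "d x z \<le> d x y + d y z" for x y z
  proof (cases "x = z")
    case True
    then show ?thesis using nonneg[of x y] nonneg[of y z] by (simp add: first_difference_dist_def)
  next
    case False
    then obtain k where k: "f x k \<noteq> f z k" using inj by (metis ext injD)
    define n where "n = (LEAST n. f x n \<noteq> f z n)"
    have "f x n \<noteq> f z n" unfolding n_def by (rule LeastI[of "\<lambda>n. f x n \<noteq> f z n", OF k])
    \<comment> \<open>Where \<open>x\<close> and \<open>z\<close> differ, \<open>y\<close> must
      differ from one of them.\<close>
    then have "r n \<le> d x y \<or> r n \<le> d y z" using r_le_dist by metis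
    moreover have "d x z = r n" using False by (simp add: first_difference_dist_def n_def)
    ultimately show ?thesis using nonneg[of x y] nonneg[of y z] by linarith
  qed
qed

text \<open>There are only countably many finite words; one point for each realised initial segment
  gives a dense set.\<close>

lemma separable:
  assumes "\<And>e. e > 0 \<Longrightarrow> \<exists>n. r n < e"
  shows "separable_space (Metric_space.mtopology X d)"
proof -
  interpret Metric_space X d by (rule Metric_space)
  define w where "w x n = map (f x) [0..<n]" for x n
  define S where "S = {w x n |x n. x \<in> X}"
  define p where "p s = (SOME x. x \<in> X \<and> (\<exists>n. w x n = s))" for s
  have p: "p s \<in> X \<and> (\<exists>n. w (p s) n = s)" if "s \<in> S" for s
    using that unfolding p_def S_def by (intro someI_ex[of "\<lambda>x. x \<in> X \<and> (\<exists>n. w x n = s)"]) auto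
  have "mtopology closure_of (p ` S) = X"
    unfolding metric_closure_of
  proof (intro equalityI subsetI CollectI conjI allI impI)
    fix x e assume x: "x \<in> X" and "(0::real) < e"
    then obtain n where n: "r n < e" using assms by blast
    have s: "w x n \<in> S" using x by (auto simp: S_def)
    then obtain k where k: "w (p (w x n)) k = w x n" using p by blast
    then have "k = n" by (metis w_def length_map length_upt diff_zero)
    then have "\<And>m. m < n \<Longrightarrow> f x m = f (p (w x n)) m" using k by (auto simp: w_def)
    then have "d x (p (w x n)) \<le> r n" by (rule dist_le_r)
    then show "\<exists>y\<in>p ` S. y \<in> mball x e" using s x n p by (intro bexI[of _ "p (w x n)"]) auto
  qed auto
  moreover have "p ` S \<subseteq> X" using p by auto
  ultimately show ?thesis
    unfolding separable_space_def by (intro exI[of _ "p ` S"]) auto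
qed

end

text \<open>The finite bound matters because \<open>real_of_ereal\<close> sends infinity to
  0.\<close>

lemma dist_le_mdiam:
  assumes "mdiam d E \<le> ereal \<delta>" "x \<in> E" "y \<in> E"
  shows "d x y \<le> real_of_ereal (mdiam d E)"
proof -
  have "ereal (d x y) \<le> mdiam d E" unfolding mdiam_def using assms by (intro Sup_upper) auto
  with assms(1) show ?thesis by (cases "mdiam d E") auto
qed

lemma mdiam_nonneg: "0 \<le> real_of_ereal (mdiam d E)"
  unfolding mdiam_def by (intro real_of_ereal_pos Sup_upper) auto

lemma hausdorff_measure_0_imp_cover:
  assumes "hausdorff_measure \<phi> X d X = 0" "0 < \<epsilon>"
  obtains E :: "nat \<Rightarrow> 'a set" where "X \<subseteq> (\<Union>i. E i)" "\<And>i. mdiam d (E i) \<le> 1"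
    "(\<Sum>i. ennreal (\<phi> (real_of_ereal (mdiam d (E i))))) < \<epsilon>"
proof -
  \<comment> \<open>Scale 1 suffices: it keeps diameters finite, while smallness will come from the
    gauge sums.\<close>
  have "hausdorff_pre \<phi> X d 1 X \<le> hausdorff_measure \<phi> X d X"
    unfolding hausdorff_measure_def by (rule SUP_upper) simp
  then have "hausdorff_pre \<phi> X d 1 X < \<epsilon>" using assms by simp
  then show thesis unfolding hausdorff_pre_def INF_less_iff using that by (auto simp: one_ereal_def)
qed

lemma gauge_function_inverse_harmonic:
  assumes "gauge_function \<phi>"
  obtains r :: "nat \<Rightarrow> real" where "\<And>n. 0 < r n" "\<And>n. \<phi> (r n) = 1 / (real n + 1)"
proof -
  have "\<exists>s\<ge>0. \<phi> s = 1 / (real n + 1)" for n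
  proof -
    have "1 / (real n + 1) \<in> \<phi> ` {0..}"
      using assms unfolding gauge_function_def bij_betw_def by simp
    then show ?thesis by auto
  qed
  then obtain r where r: "\<And>n. r n \<ge> 0" "\<And>n. \<phi> (r n) = 1 / (real n + 1)" by metis
  have "0 \<in> \<phi> ` {0..}" using assms unfolding gauge_function_def bij_betw_def by simp
  then obtain z where z: "z \<ge> 0" "\<phi> z = 0" by auto
  have "r n > 0" for n
  proof (rule ccontr)
    assume "\<not> ?thesis"
    then have "r n \<le> z" using z(1) by linarith
    then have "\<phi> (r n) \<le> \<phi> z"
      using assms r(1)[of n] z(1) unfolding gauge_function_def
      by (auto simp: strict_mono_on_leD)
    then show False using r(2)[of n] z(2) by (simp add: field_simps)
  qed
  with r(2) show thesis using that by blast
qed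

lemma eventually_different_imp_hausdorff_measure_pos:
  fixes f :: "'a \<Rightarrow> nat \<Rightarrow> nat"
  assumes \<phi>: "gauge_function \<phi>"
    and r: "\<And>n. 0 < r n" "\<And>n. \<phi> (r n) = 1 / (real n + 1)"
    and d: "\<And>x y n. f x n \<noteq> f y n \<Longrightarrow> r n \<le> d x y"
    and f: "\<And>g. \<exists>x\<in>X. finite {n. f x n = g n}"
  shows "hausdorff_measure \<phi> X d X > 0"
proof (rule ccontr)
  assume "\<not> ?thesis"
  then have H: "hausdorff_measure \<phi> X d X = 0" by (simp add: not_less)
  have mono: "\<phi> s \<le> \<phi> t" if "0 \<le> s" "s \<le> t" for s t
    using \<phi> that unfolding gauge_function_def by (auto simp: strict_mono_on_leD)
  have \<phi>_nonneg: "0 \<le> \<phi> s" if "0 \<le> s" for s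
    using \<phi> that unfolding gauge_function_def bij_betw_def by auto
  let ?b = "\<lambda>A. \<phi> (real_of_ereal (mdiam d A))"
  have b_nonneg: "0 \<le> ?b A" for A by (intro \<phi>_nonneg mdiam_nonneg)
  have "\<forall>m. \<exists>E :: nat \<Rightarrow> 'a set. X \<subseteq> (\<Union>i. E i) \<and> (\<forall>i. mdiam d (E i) \<le> 1) \<and>
      (\<Sum>i. ennreal (?b (E i))) < ennreal ((1/2) ^ (m + 2))"
  proof
    fix m :: nat
    have "0 < ennreal ((1/2) ^ (m + 2))" by simp
    from hausdorff_measure_0_imp_cover[OF H this]
    show "\<exists>E :: nat \<Rightarrow> 'a set. X \<subseteq> (\<Union>i. E i) \<and> (\<forall>i. mdiam d (E i) \<le> 1) \<and>
      (\<Sum>i. ennreal (?b (E i))) < ennreal ((1/2) ^ (m + 2))" by metis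
  qed
  then obtain E :: "nat \<Rightarrow> nat \<Rightarrow> 'a set" where
    E: "\<And>m. X \<subseteq> (\<Union>i. E m i)" "\<And>m i. mdiam d (E m i) \<le> 1"
      "\<And>m. (\<Sum>i. ennreal (?b (E m i))) < ennreal ((1/2) ^ (m + 2))" by metis
  define C where "C p = (case prod_decode p of (m, i) \<Rightarrow> E m i)" for p
  have C_diam: "mdiam d (C p) \<le> ereal 1" for p
    using E(2) by (auto simp: C_def one_ereal_def split: prod.split)
  have geo: "(\<lambda>m. (1/2) ^ (m + 2)) sums (1/2 :: real)"
    using sums_mult2[OF geometric_sums[of "1/2 :: real"], of "1/4"] by (simp add: power_add power2_eq_square)
  have "(\<Sum>p. ennreal (?b (C p))) = (\<Sum>m. \<Sum>i. ennreal (?b (E m i)))"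
    using suminf_ennreal_2dimen[of "\<lambda>m. \<Sum>i. ennreal (?b (E m i))" "\<lambda>(m, i). ennreal (?b (E m i))"]
    by (simp add: C_def case_prod_unfold)
  also have "\<dots> \<le> (\<Sum>m. ennreal ((1/2) ^ (m + 2)))"
    by (intro suminf_le less_imp_le[OF E(3)]) auto
  also have "\<dots> = ennreal (1/2)"
    by (rule suminf_ennreal_eq[OF _ geo]) simp
  finally have total: "(\<Sum>p. ennreal (?b (C p))) \<le> ennreal (1/2)" .
  \<comment> \<open>The covers use up at most 1/2 of the total. The added terms, again of sum 1/2,
    make all weights positive, even for sets of diameter 0, and strictly larger than the gauge
    values.\<close>
  define a where "a p = ?b (C p) + (1/2) ^ (p + 2)" for p
  have "sum a S \<le> 1" if S: "finite S" for S
  proof -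
    have "ennreal (\<Sum>p\<in>S. ?b (C p)) = (\<Sum>p\<in>S. ennreal (?b (C p)))"
      by (simp add: b_nonneg sum_ennreal)
    also have "\<dots> \<le> (\<Sum>p. ennreal (?b (C p)))" by (rule sum_le_suminf) (auto simp: S)
    also note total
    finally have "(\<Sum>p\<in>S. ?b (C p)) \<le> 1/2" by (subst (asm) ennreal_le_iff) auto
    moreover have "(\<Sum>p\<in>S. (1/2) ^ (p + 2)) \<le> (1/2 :: real)"
      by (rule order_trans[OF sum_le_suminf[OF sums_summable[OF geo] S] eq_refl[OF sums_unique[OF geo, symmetric]]]) simp
    ultimately show ?thesis by (simp add: a_def sum.distrib)
  qed
  moreover have "a p > 0" for p using b_nonneg[of "C p"] by (simp add: a_def add_nonneg_pos)
  ultimately obtain n where n: "inj n" "\<And>p. a p \<le> 1 / (real (n p) + 1)"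
    using rank_injection by blast
  have agree: "f x (n p) = f y (n p)" if "x \<in> C p" "y \<in> C p" for x y p
  proof (rule ccontr)
    assume "\<not> ?thesis"
    then have "r (n p) \<le> real_of_ereal (mdiam d (C p))"
      using d dist_le_mdiam[OF C_diam that] order_trans by blast
    then have "1 / (real (n p) + 1) \<le> ?b (C p)" using mono r less_imp_le by metis
    also have "\<dots> < a p" by (simp add: a_def)
    finally show False using n(2)[of p] by linarith
  qed
  \<comment> \<open>At \<open>k = n p\<close> this is the common value on \<open>C p\<close>; it is
    arbitrary if that set is empty or \<open>k\<close> is outside the range of
    \<open>n\<close>.\<close>
  define g where "g k = f (SOME x. x \<in> C (inv n k)) k" for k
  have g: "f x (n p) = g (n p)" if "x \<in> C p" for x p
    using agree[OF that someI[of "\<lambda>x. x \<in> C p", OF that]] n(1) by (simp add: g_def)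
  obtain x where x: "x \<in> X" "finite {k. f x k = g k}" using f by blast
  \<comment> \<open>Every row covers \<open>X\<close>, so \<open>x\<close> lies in infinitely many
    listed sets, and injectivity of \<open>n\<close> yields infinitely many agreements.\<close>
  have "\<forall>m. \<exists>i. x \<in> E m i" using E(1) x(1) by blast
  then obtain i where i: "\<And>m. x \<in> E m (i m)" by metis
  have "inj (\<lambda>m. n (prod_encode (m, i m)))"
    by (rule injI) (simp add: inj_eq[OF n(1)])
  then have "infinite (range (\<lambda>m. n (prod_encode (m, i m))))" by (simp add: finite_image_iff)
  moreover have "range (\<lambda>m. n (prod_encode (m, i m))) \<subseteq> {k. f x k = g k}"
    using g i by (auto simp: C_def)
  ultimately show False using x(2) finite_subset by blast
qed

section \<open>A minimal cover and the resulting space\<close>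

text \<open>Well-ordering of cardinals provides a least cover. Comparison with the cover by
  singletons embeds it into the reals, which serve as its index set.\<close>

lemma exists_has_card_cov_meager:
  includes cardinal_syntax
  obtains X :: "real set" and M :: "real \<Rightarrow> real set"
  where "has_card_cov_meager X" "\<And>x. x \<in> X \<Longrightarrow> first_category (M x)" "(\<Union>x\<in>X. M x) = UNIV"
proof -
  define P where "P = {\<F>. (\<forall>A\<in>\<F>. first_category A) \<and> \<Union>\<F> = UNIV}"
  have sing: "range (\<lambda>x. {x}) \<in> P"
    unfolding P_def first_category_def
    by (auto simp: nowhere_dense_def intro!: exI[of _ "{{_}}"])
  have "\<exists>r\<in>card_of ` P. \<forall>r'\<in>card_of ` P. r \<le>o r'"
    using sing by (intro exists_minim_Card_order) (auto simp: card_of_Card_order)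
  then obtain \<F> where F: "\<F> \<in> P" "\<And>\<G>. \<G> \<in> P \<Longrightarrow> \<F> \<lesssim> \<G>"
    by (auto simp: lepoll_def card_of_ordLeq[symmetric])
  have "\<F> \<lesssim> (UNIV :: real set)"
    using F(2)[OF sing] image_lepoll lepoll_trans by blast
  then obtain e :: "real set \<Rightarrow> real" where e: "inj_on e \<F>" unfolding lepoll_def by blast
  have eq: "e ` \<F> \<approx> \<F>" using e by (rule inj_on_image_eqpoll_self)
  have inv: "inv_into \<F> e ` e ` \<F> = \<F>" using e by (simp add: inv_into_image_cancel)
  show thesis
  proof (rule that[of "e ` \<F>" "inv_into \<F> e"])
    show "has_card_cov_meager (e ` \<F>)"
      unfolding has_card_cov_meager_def
      using F eq lepoll_trans1[OF eq] unfolding P_def by blast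
    show "first_category (inv_into \<F> e x)" if "x \<in> e ` \<F>" for x
      using F(1) inv_into_into[OF that] unfolding P_def by simp
    show "(\<Union>x\<in>e ` \<F>. inv_into \<F> e x) = UNIV" using F(1) inv unfolding P_def by simp
  qed
qed

text \<open>A real is coded by its Dedekind cut along an enumeration of the rationals.\<close>

lemma inj_real_into_baire_space:
  obtains y :: "real \<Rightarrow> nat \<Rightarrow> nat" where "inj y"
proof
  show "inj (\<lambda>(x::real) n. if of_rat (from_nat n) < x then 1 else (0::nat))"
  proof (rule linorder_injI)
    fix x z :: real assume "x < z"
    then obtain q where "x < of_rat q" "of_rat q < z" using of_rat_dense by blast
    then show "(\<lambda>n. if of_rat (from_nat n) < x then 1 else (0::nat)) \<noteq>
        (\<lambda>n. if of_rat (from_nat n) < z then 1 else 0)"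
      by (intro notI) (auto dest!: fun_cong[of _ _ "to_nat q"])
  qed
qed

theorem theorem3p8:
  fixes \<phi> :: "real \<Rightarrow> real"
  assumes "gauge_function \<phi>"
  shows "\<exists>(X :: real set) (d :: real \<Rightarrow> real \<Rightarrow> real).
           Metric_space X d \<and> separable_space (Metric_space.mtopology X d) \<and>
           has_card_cov_meager X \<and> hausdorff_measure \<phi> X d X > 0"
proof -
  obtain X :: "real set" and M :: "real \<Rightarrow> real set" where
    card: "has_card_cov_meager X" and
    M: "\<And>x. x \<in> X \<Longrightarrow> first_category (M x)" "(\<Union>x\<in>X. M x) = UNIV"
    by (rule exists_has_card_cov_meager) blast
  obtain f0 :: "real \<Rightarrow> nat \<Rightarrow> nat" where f0: "\<And>g. \<exists>x\<in>X. finite {n. f0 x n = g n}"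
    using eventually_different_family[OF M] by blast
  obtain y :: "real \<Rightarrow> nat \<Rightarrow> nat" where y: "inj y" by (rule inj_real_into_baire_space)
  \<comment> \<open>pairing with \<open>y\<close> makes \<open>f\<close> injective, so that \<open>X\<close> itself carries the metric\<close>
  define f where "f x n = prod_encode (f0 x n, y x n)" for x n
  have "inj f"
    using y by (auto simp: inj_def f_def fun_eq_iff)
  have f: "\<exists>x\<in>X. finite {n. f x n = g n}" for g
  proof -
    obtain x where x: "x \<in> X" "finite {n. f0 x n = fst (prod_decode (g n))}"
      using f0[of "\<lambda>n. fst (prod_decode (g n))"] by blast
    have "{n. f x n = g n} \<subseteq> {n. f0 x n = fst (prod_decode (g n))}"
      by (auto simp: f_def dest: sym)
    then show ?thesis using x finite_subset by blast
  qed
  obtain r where r: "\<And>n. 0 < r n" "\<And>n. \<phi> (r n) = 1 / (real n + 1)"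
    using gauge_function_inverse_harmonic[OF assms] by blast
  have strict: "\<phi> s < \<phi> t" if "0 \<le> s" "s < t" for s t
    using assms that unfolding gauge_function_def strict_mono_on_def by auto
  have anti: "r n \<le> r m" if "m \<le> n" for m n
  proof (rule ccontr)
    assume "\<not> ?thesis"
    then have "\<phi> (r m) < \<phi> (r n)"
      using strict r(1)[of m] by simp
    then show False using that by (simp add: r(2) field_simps)
  qed
  have small: "\<exists>n. r n < e" if "e > 0" for e
  proof -
    have "0 \<le> \<phi> 0" using assms unfolding gauge_function_def bij_betw_def by auto
    then have "0 < \<phi> e" using strict[of 0 e] that by simp
    then obtain n where "1 / (real n + 1) < \<phi> e"
      using reals_Archimedean[of "\<phi> e"] by (auto simp: inverse_eq_divide add.commute)
    then have "\<phi> (r n) < \<phi> e" by (simp add: r(2))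
    then have "r n < e" using strict[of e "r n"] that by (cases "r n" e rule: linorder_cases) auto
    then show ?thesis by blast
  qed
  interpret first_difference r f
    by standard (use \<open>inj f\<close> r anti in auto)
  have "hausdorff_measure \<phi> X d X > 0"
    by (rule eventually_different_imp_hausdorff_measure_pos[OF assms r r_le_dist f])
  then show ?thesis using Metric_space separable[OF small] card by blast
qed

end
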